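(* Let $K(a_{n,k})$ be a Köthe space, let $\Lambda_1(\beta)$ be a power series space of finite type, let $\theta=(\theta_t)_{t\ge 0}$ be a scalar sequence and $s_0=\min\{t:\theta_t\neq 0\}$. Then $\hat T_\theta:K(a_{n,k})\to\Lambda_1(\beta)$ is well-defined and continuous if and only if $\theta\in\Lambda_1(\beta)$ and $$\forall k\in\mathbb{N}\ \exists m\in\mathbb{N},\,C>0\ \ \forall n\in\mathbb{N}:\quad e^{-\frac1k\beta_{n+s_0}}\le C a_{n,m}.$$
   Context: $\mathbb{N}=\{1,2,3,\dots\}$. A Köthe matrix is a matrix $(a_{n,k})_{n,k\in\mathbb{N}}$ of non-negative numbers such that for each $n$ there is $k$ with $a_{n,k}>0$, and $a_{n,k}\le a_{n,k+1}$ for all $n,k$. The Köthe space is $K(a_{n,k})=\{x=(x_n)_{n\in\mathbb{N}}:\|x\|_k:=\sum_n|x_n|a_{n,k}<\infty\ \forall k\in\mathbb{N}\}$, a Fréchet space with the seminorms $\|\cdot\|_k$. For $\beta=(\beta_n)_{n\in\mathbb{N}}$ non-negative, increasing, with $\beta_n\to\infty$, the power series space of finite type $\Lambda_1(\beta)$ is the Köthe space with matrix $(e^{-\frac1k\beta_n})_{n,k}$. $e_n$ is the sequence with $1$ in the $n$-th place and $0$ elsewhere. For a sequence $\theta=(\theta_0,\theta_1,\theta_2,\dots)$ (regarded as an element of a sequence space indexed by $\mathbb{N}$ by letting its $n$-th coordinate be $\theta_{n-1}$), the operator $\hat T_\theta$ given by the lower triangular Toeplitz matrix of $\theta$ is $\hat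 T_\theta e_n=\sum_{j=n}^\infty\theta_{j-n}e_j$, $\hat T_\theta x=\sum_n x_n\hat T_\theta e_n$ for $x=\sum_n x_ne_n$; it is well-defined if each $\hat T_\theta e_n$ lies in the target space and the series converges there for every $x$ in the domain. Standing assumption: $\theta_t\ne 0$ for infinitely many $t$. *)

theory Defs
  imports "HOL-Analysis.Analysis"
begin

text \<open>
  Indices are shifted by one: the entries \<open>x n\<close>, \<open>a n k\<close>, \<open>\<beta> n\<close> (with \<open>n, k \<ge> 0\<close>) stand for
  the mathematical \<open>x\<^sub>n\<^sub>+\<^sub>1\<close>, \<open>a\<^sub>n\<^sub>+\<^sub>1\<^sub>,\<^sub>k\<^sub>+\<^sub>1\<close>, \<open>\<beta>\<^sub>n\<^sub>+\<^sub>1\<close>, whose indices start at 1. A sequence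
  \<open>\<theta>\<close> indexed from 0 is then literally an element of a sequence space.
  The scalars are an arbitrary \<open>real_normed_field\<close>, which covers both the real and the complex case.
\<close>

definition koethe_matrix :: "(nat \<Rightarrow> nat \<Rightarrow> real) \<Rightarrow> bool" where
  "koethe_matrix a \<longleftrightarrow>
     (\<forall>n k. 0 \<le> a n k) \<and> (\<forall>n. \<exists>k. 0 < a n k) \<and> (\<forall>n k. a n k \<le> a n (Suc k))"

definition koethe_space :: "(nat \<Rightarrow> nat \<Rightarrow> real) \<Rightarrow> (nat \<Rightarrow> 'a::real_normed_field) set" where
  "koethe_space a = {x. \<forall>k. summable (\<lambda>n. norm (x n) * a n k)}"

definition koethe_seminorm ::
    "(nat \<Rightarrow> nat \<Rightarrow> real) \<Rightarrow> nat \<Rightarrow> (nat \<Rightarrow> 'a::real_normed_field) \<Rightarrow> real" where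
  "koethe_seminorm a k x = (\<Sum>n. norm (x n) * a n k)"

definition koethe_topology ::
    "(nat \<Rightarrow> nat \<Rightarrow> real) \<Rightarrow> (nat \<Rightarrow> 'a::real_normed_field) topology" where
  "koethe_topology a = topology_generated_by
     {{y \<in> koethe_space a. koethe_seminorm a k (\<lambda>n. y n - x n) < \<epsilon>} | x k \<epsilon>.
        x \<in> koethe_space a \<and> 0 < \<epsilon>}"

definition exponent_sequence :: "(nat \<Rightarrow> real) \<Rightarrow> bool" where
  "exponent_sequence \<beta> \<longleftrightarrow> (\<forall>n. 0 \<le> \<beta> n) \<and> incseq \<beta> \<and> filterlim \<beta> at_top sequentially"

definition finite_type_matrix :: "(nat \<Rightarrow> real) \<Rightarrow> nat \<Rightarrow> nat \<Rightarrow> real" where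
  "finite_type_matrix \<beta> n k = exp (- (1 / real (Suc k)) * \<beta> n)"

abbreviation power_series_space_finite_type ::
    "(nat \<Rightarrow> real) \<Rightarrow> (nat \<Rightarrow> 'a::real_normed_field) set" where
  "power_series_space_finite_type \<beta> \<equiv> koethe_space (finite_type_matrix \<beta>)"

text \<open>The \<open>n\<close>-th column of the lower triangular Toeplitz matrix of \<open>\<theta>\<close>, i.e. the image of the
  \<open>n\<close>-th unit sequence.\<close>

definition toeplitz_column :: "(nat \<Rightarrow> 'a::real_normed_field) \<Rightarrow> nat \<Rightarrow> nat \<Rightarrow> 'a" where
  "toeplitz_column \<theta> n j = (if n \<le> j then \<theta> (j - n) else 0)"

definition toeplitz_sums_to ::
    "(nat \<Rightarrow> nat \<Rightarrow> real) \<Rightarrow> (nat \<Rightarrow> 'a::real_normed_field) \<Rightarrow> (nat \<Rightarrow> 'a) \<Rightarrow> (nat \<Rightarrow> 'a) \<Rightarrow> bool" where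
  "toeplitz_sums_to b \<theta> x y \<longleftrightarrow>
     limitin (koethe_topology b) (\<lambda>N j. \<Sum>n<N. x n * toeplitz_column \<theta> n j) y sequentially"

definition toeplitz_operator ::
    "(nat \<Rightarrow> nat \<Rightarrow> real) \<Rightarrow> (nat \<Rightarrow> 'a::real_normed_field) \<Rightarrow> (nat \<Rightarrow> 'a) \<Rightarrow> (nat \<Rightarrow> 'a)" where
  "toeplitz_operator b \<theta> x = (THE y. toeplitz_sums_to b \<theta> x y)"

definition toeplitz_well_defined ::
    "(nat \<Rightarrow> nat \<Rightarrow> real) \<Rightarrow> (nat \<Rightarrow> nat \<Rightarrow> real) \<Rightarrow> (nat \<Rightarrow> 'a::real_normed_field) \<Rightarrow> bool" where
  "toeplitz_well_defined a b \<theta> \<longleftrightarrow>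
     (\<forall>n. toeplitz_column \<theta> n \<in> koethe_space b) \<and>
     (\<forall>x \<in> koethe_space a. \<exists>y. toeplitz_sums_to b \<theta> x y)"

lemma topspace_koethe_topology [simp]:
  "topspace (koethe_topology a) = (koethe_space a :: (nat \<Rightarrow> 'a::real_normed_field) set)"
proof (intro equalityI subsetI)
  fix x :: "nat \<Rightarrow> 'a"
  assume "x \<in> topspace (koethe_topology a)"
  then show "x \<in> koethe_space a"
    unfolding koethe_topology_def topology_generated_by_topspace by auto
next
  fix x :: "nat \<Rightarrow> 'a"
  assume x: "x \<in> koethe_space a"
  let ?B = "{y \<in> koethe_space a. koethe_seminorm a 0 (\<lambda>n. y n - x n) < 1}"
  have "x \<in> ?B"
    using x by (simp add: koethe_seminorm_def)
  moreover have "\<exists>x' k \<epsilon>. ?B = {y \<in> koethe_space a. koethe_seminorm a k (\<lambda>n. y n - x' n) < \<epsilon>} \<and>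
      x' \<in> koethe_space a \<and> 0 < \<epsilon>"
    by (rule exI[of _ x], rule exI[of _ 0], rule exI[of _ 1]) (simp add: x)
  ultimately show "x \<in> topspace (koethe_topology a)"
    unfolding koethe_topology_def topology_generated_by_topspace
    by (intro UnionI[of ?B]) (rule CollectI)
qed

lemma koethe_matrix_finite_type:
  assumes "exponent_sequence \<beta>"
  shows "koethe_matrix (finite_type_matrix \<beta>)"
proof -
  have "\<beta> n / real (Suc (Suc k)) \<le> \<beta> n / real (Suc k)" for n k
    using assms by (intro divide_left_mono) (auto simp: exponent_sequence_def)
  then show ?thesis
    unfolding koethe_matrix_def finite_type_matrix_def by (simp del: of_nat_Suc)
qed

end

theory Submission
  imports Defs
begin

text \<open>
  Coordinatewise, the operator is the convolution \<open>y\<^sub>j = (\<Sum>n\<le>j. x\<^sub>n \<theta>\<^sub>j\<^sub>-\<^sub>n)\<close>, a finite sum, so that no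
  completeness of the scalars enters. Two observations carry the theorem.

  A map between Koethe spaces given by a matrix is controlled by its columns: if the \<open>k\<close>-th seminorm
  of the \<open>n\<close>-th column is at most \<open>C * a n m\<close> for all \<open>n\<close>, then exchanging the order of summation
  bounds the \<open>k\<close>-th seminorm of the image of \<open>x\<close> by \<open>C\<close> times the \<open>m\<close>-th seminorm of \<open>x\<close>
  (\<open>toeplitz_image_bound\<close>). Applied to differences this gives continuity, and applied to the tails
  of \<open>x\<close> it gives convergence of the series of columns.

  For a finite type target the column bound follows from the estimate of its leading entry. Since
  \<open>\<beta>\<close> increases, \<open>\<beta> (n + t)\<close> is at least the mean of \<open>\<beta> (n + s0)\<close> and \<open>\<beta> t\<close> for \<open>t \<ge> s0\<close>; hence
  the \<open>k\<close>-th weight at \<open>n + t\<close> is at most the product of the weights at \<open>n + s0\<close> and at \<open>t\<close> of the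
  index with twice the denominator, and summation over \<open>t\<close> against \<open>\<theta>\<close> only costs a seminorm
  of \<open>\<theta>\<close> (\<open>toeplitz_column_seminorm_le\<close>).

  Conversely, \<open>\<theta>\<close> is the column with index 0, and continuity at 0, tested on multiples of the unit
  sequences, bounds every weighted entry of the \<open>n\<close>-th column by \<open>C * a n m\<close>
  (\<open>toeplitz_column_entry_bound\<close>); the entry at position \<open>n + s0\<close> is \<open>\<theta> s0 \<noteq> 0\<close>.
\<close>

section \<open>Seminorms and topology of Koethe spaces\<close>

lemma koethe_matrix_nonneg: "koethe_matrix a \<Longrightarrow> 0 \<le> a n k"
  by (simp add: koethe_matrix_def)

lemma koethe_matrix_mono: "koethe_matrix a \<Longrightarrow> k \<le> l \<Longrightarrow> a n k \<le> a n l"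
  by (rule lift_Suc_mono_le) (auto simp: koethe_matrix_def)

lemma koethe_space_diff:
  fixes x y :: "nat \<Rightarrow> 'a::real_normed_field"
  assumes a: "koethe_matrix a" and x: "x \<in> koethe_space a" and y: "y \<in> koethe_space a"
  shows "(\<lambda>n. x n - y n) \<in> koethe_space a"
proof -
  have "summable (\<lambda>n. norm (x n - y n) * a n k)" for k
  proof (rule summable_comparison_test')
    show "summable (\<lambda>n. norm (x n) * a n k + norm (y n) * a n k)"
      using x y by (auto simp: koethe_space_def intro: summable_add)
    show "norm (norm (x n - y n) * a n k) \<le> norm (x n) * a n k + norm (y n) * a n k" for n
      using mult_right_mono[OF norm_triangle_ineq4[of "x n" "y n"] koethe_matrix_nonneg[OF a, of n k]]
        koethe_matrix_nonneg[OF a, of n k] by (simp add: distrib_right)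
  qed
  then show ?thesis by (simp add: koethe_space_def)
qed

lemma koethe_seminorm_triangle:
  fixes x y z :: "nat \<Rightarrow> 'a::real_normed_field"
  assumes a: "koethe_matrix a"
    and mem: "x \<in> koethe_space a" "y \<in> koethe_space a" "z \<in> koethe_space a"
  shows "koethe_seminorm a k (\<lambda>n. x n - z n)
    \<le> koethe_seminorm a k (\<lambda>n. x n - y n) + koethe_seminorm a k (\<lambda>n. y n - z n)"
proof -
  have s: "summable (\<lambda>n. norm (x n - z n) * a n k)" "summable (\<lambda>n. norm (x n - y n) * a n k)"
      "summable (\<lambda>n. norm (y n - z n) * a n k)"
    using koethe_space_diff[OF a] mem by (auto simp: koethe_space_def)
  have "norm (x n - z n) * a n k \<le> norm (x n - y n) * a n k + norm (y n - z n) * a n k" for n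
    using mult_right_mono[OF norm_triangle_ineq[of "x n - y n" "y n - z n"]
        koethe_matrix_nonneg[OF a, of n k]] by (simp add: distrib_right)
  then show ?thesis
    unfolding koethe_seminorm_def suminf_add[OF s(2,3)]
    by (intro suminf_le s summable_add)
qed

lemma koethe_seminorm_mono:
  assumes a: "koethe_matrix a" and x: "x \<in> koethe_space a" and "k \<le> l"
  shows "koethe_seminorm a k x \<le> koethe_seminorm a l x"
  using x unfolding koethe_seminorm_def koethe_space_def
  by (intro suminf_le mult_left_mono koethe_matrix_mono[OF a \<open>k \<le> l\<close>]) auto

lemma coordinate_le_koethe_seminorm:
  assumes a: "koethe_matrix a" and x: "x \<in> koethe_space a"
  shows "norm (x j) * a j k \<le> koethe_seminorm a k x"
  using sum_le_suminf[of "\<lambda>n. norm (x n) * a n k" "{j}"] x koethe_matrix_nonneg[OF a]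
  by (simp add: koethe_seminorm_def koethe_space_def)

abbreviation koethe_ball ::
    "(nat \<Rightarrow> nat \<Rightarrow> real) \<Rightarrow> nat \<Rightarrow> (nat \<Rightarrow> 'a::real_normed_field) \<Rightarrow> real \<Rightarrow> (nat \<Rightarrow> 'a) set" where
  "koethe_ball a k x \<epsilon> \<equiv> {y \<in> koethe_space a. koethe_seminorm a k (\<lambda>n. y n - x n) < \<epsilon>}"

lemma openin_koethe_ball:
  "x \<in> koethe_space a \<Longrightarrow> 0 < \<epsilon> \<Longrightarrow> openin (koethe_topology a) (koethe_ball a k x \<epsilon>)"
  unfolding koethe_topology_def by (rule topology_generated_by_Basis) blast

text \<open>
  The topology is generated by the balls as a subbase. As the seminorms increase with their index,
  the intersection of two balls around a point contains a third one, so the balls are in fact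
  neighbourhood bases.
\<close>

lemma openin_koethe_topology_iff:
  fixes U :: "(nat \<Rightarrow> 'a::real_normed_field) set"
  assumes a: "koethe_matrix a"
  shows "openin (koethe_topology a) U \<longleftrightarrow>
    U \<subseteq> koethe_space a \<and> (\<forall>x\<in>U. \<exists>k. \<exists>\<epsilon>>0. koethe_ball a k x \<epsilon> \<subseteq> U)"
proof
  assume U: "openin (koethe_topology a) U"
  then have sub: "U \<subseteq> koethe_space a"
    using openin_subset by fastforce
  have "\<exists>k. \<exists>\<epsilon>>0. koethe_ball a k x \<epsilon> \<subseteq> U" if "x \<in> U" for x
    using U[unfolded koethe_topology_def openin_topology_generated_by_iff] that
  proof (induction arbitrary: x rule: generate_topology_on.induct)
    case Empty
    then show ?case by simp
  next
    case (Int V W)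
    obtain k \<epsilon> where k: "\<epsilon> > 0" "koethe_ball a k x \<epsilon> \<subseteq> V"
      using Int by blast
    obtain l \<delta> where l: "\<delta> > 0" "koethe_ball a l x \<delta> \<subseteq> W"
      using Int by blast
    have "openin (koethe_topology a) V"
      using Int by (simp add: koethe_topology_def openin_topology_generated_by_iff)
    then have x: "x \<in> koethe_space a"
      using openin_subset[of "koethe_topology a" V] Int by auto
    have "koethe_ball a (max k l) x (min \<epsilon> \<delta>) \<subseteq> V \<inter> W"
    proof
      fix y assume y: "y \<in> koethe_ball a (max k l) x (min \<epsilon> \<delta>)"
      then have "(\<lambda>n. y n - x n) \<in> koethe_space a"
        using koethe_space_diff[OF a _ x] by blast
      then have "koethe_seminorm a k (\<lambda>n. y n - x n) \<le> koethe_seminorm a (max k l) (\<lambda>n. y n - x n)"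
        "koethe_seminorm a l (\<lambda>n. y n - x n) \<le> koethe_seminorm a (max k l) (\<lambda>n. y n - x n)"
        by (simp_all add: koethe_seminorm_mono[OF a])
      then show "y \<in> V \<inter> W"
        using y k l by auto
    qed
    moreover have "min \<epsilon> \<delta> > 0"
      using k l by simp
    ultimately show ?case
      by blast
  next
    case (UN K)
    then obtain V where V: "V \<in> K" "x \<in> V"
      by blast
    with UN.IH obtain k \<epsilon> where "\<epsilon> > 0" "koethe_ball a k x \<epsilon> \<subseteq> V"
      by blast
    with V show ?case
      by (meson Union_upper subset_trans)
  next
    case (Basis V)
    then obtain z k \<epsilon> where V: "V = koethe_ball a k z \<epsilon>" and z: "z \<in> koethe_space a" "0 < \<epsilon>"
      by blast
    let ?\<delta> = "\<epsilon> - koethe_seminorm a k (\<lambda>n. x n - z n)"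
    have "?\<delta> > 0" using Basis V by simp
    moreover have "koethe_ball a k x ?\<delta> \<subseteq> V"
    proof
      fix y assume "y \<in> koethe_ball a k x ?\<delta>"
      then show "y \<in> V"
        using koethe_seminorm_triangle[OF a _ _ z(1), of y x k] Basis(2) V by simp
    qed
    ultimately show ?case by blast
  qed
  with sub show "U \<subseteq> koethe_space a \<and> (\<forall>x\<in>U. \<exists>k. \<exists>\<epsilon>>0. koethe_ball a k x \<epsilon> \<subseteq> U)"
    by blast
next
  assume U: "U \<subseteq> koethe_space a \<and> (\<forall>x\<in>U. \<exists>k. \<exists>\<epsilon>>0. koethe_ball a k x \<epsilon> \<subseteq> U)"
  show "openin (koethe_topology a) U"
  proof (subst openin_subopen, intro ballI)
    fix x assume x: "x \<in> U"
    then obtain k \<epsilon> where k: "\<epsilon> > 0" "koethe_ball a k x \<epsilon> \<subseteq> U" and mem: "x \<in> koethe_space a"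
      using U by blast
    have "x \<in> koethe_ball a k x \<epsilon>"
      using k mem by (simp add: koethe_seminorm_def)
    with openin_koethe_ball[OF mem k(1), of k] k(2)
    show "\<exists>T. openin (koethe_topology a) T \<and> x \<in> T \<and> T \<subseteq> U"
      by (intro exI[of _ "koethe_ball a k x \<epsilon>"] conjI)
  qed
qed

lemma limitin_koetheI:
  assumes a: "koethe_matrix a" and "l \<in> koethe_space a" and "\<And>N. f N \<in> koethe_space a"
    and lim: "\<And>k. (\<lambda>N. koethe_seminorm a k (\<lambda>n. f N n - l n)) \<longlonglongrightarrow> 0"
  shows "limitin (koethe_topology a) f l sequentially"
  unfolding limitin_def
proof (intro conjI allI impI)
  show "l \<in> topspace (koethe_topology a)"
    using assms by simp
  fix U assume "openin (koethe_topology a) U \<and> l \<in> U"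
  then obtain k \<epsilon> where "\<epsilon> > 0" and sub: "koethe_ball a k l \<epsilon> \<subseteq> U"
    using openin_koethe_topology_iff[OF a] by blast
  then have "\<forall>\<^sub>F N in sequentially. koethe_seminorm a k (\<lambda>n. f N n - l n) < \<epsilon>"
    using order_tendstoD(2)[OF lim] by blast
  then show "\<forall>\<^sub>F N in sequentially. f N \<in> U"
    by eventually_elim (use sub assms in auto)
qed

text \<open>
  Each coordinate is seen by some seminorm, because no row of a Koethe matrix vanishes. In
  particular the topology is Hausdorff, and limits can be read off coordinatewise.
\<close>

lemma limitin_koethe_coordinate:
  assumes a: "koethe_matrix a" and f: "limitin (koethe_topology a) f l sequentially"
  shows "(\<lambda>N. f N j) \<longlonglongrightarrow> l j"
proof (rule tendstoI)
  fix e :: real assume "e > 0"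
  obtain k where k: "a j k > 0"
    using a unfolding koethe_matrix_def by blast
  have l: "l \<in> koethe_space a"
    using limitin_topspace[OF f] by simp
  have "l \<in> koethe_ball a k l (e * a j k)"
    using l k \<open>e > 0\<close> by (simp add: koethe_seminorm_def)
  then have "\<forall>\<^sub>F N in sequentially. f N \<in> koethe_ball a k l (e * a j k)"
    using f openin_koethe_ball[OF l, of "e * a j k" k] k \<open>e > 0\<close> by (auto simp: limitin_def)
  then show "\<forall>\<^sub>F N in sequentially. dist (f N j) (l j) < e"
  proof eventually_elim
    case (elim N)
    then have "norm (f N j - l j) * a j k < e * a j k"
      using coordinate_le_koethe_seminorm[OF a koethe_space_diff[OF a _ l, of "f N"], of j k] by simp
    then show ?case
      using k by (simp add: dist_norm)
  qed
qed

lemma continuous_map_koetheI: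
  fixes f :: "(nat \<Rightarrow> 'a::real_normed_field) \<Rightarrow> (nat \<Rightarrow> 'b::real_normed_field)"
  assumes a: "koethe_matrix a" and b: "koethe_matrix b"
    and f: "\<And>x. x \<in> koethe_space a \<Longrightarrow> f x \<in> koethe_space b"
    and bound: "\<And>k. \<exists>m. \<exists>C>0. \<forall>x\<in>koethe_space a. \<forall>y\<in>koethe_space a.
      koethe_seminorm b k (\<lambda>j. f y j - f x j) \<le> C * koethe_seminorm a m (\<lambda>n. y n - x n)"
  shows "continuous_map (koethe_topology a) (koethe_topology b) f"
  unfolding continuous_map_def
proof (intro conjI allI impI)
  show "f \<in> topspace (koethe_topology a) \<rightarrow> topspace (koethe_topology b)"
    using f by simp
  fix U :: "(nat \<Rightarrow> 'b) set" assume U: "openin (koethe_topology b) U"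
  show "openin (koethe_topology a) {x \<in> topspace (koethe_topology a). f x \<in> U}"
    unfolding openin_koethe_topology_iff[OF a]
  proof (intro conjI ballI)
    fix x assume "x \<in> {x \<in> topspace (koethe_topology a). f x \<in> U}"
    then have x: "x \<in> koethe_space a" "f x \<in> U"
      by auto
    then obtain k \<epsilon> where "\<epsilon> > 0" and sub: "koethe_ball b k (f x) \<epsilon> \<subseteq> U"
      using U openin_koethe_topology_iff[OF b] by blast
    obtain m C where "C > 0" and C: "\<And>y. y \<in> koethe_space a \<Longrightarrow>
        koethe_seminorm b k (\<lambda>j. f y j - f x j) \<le> C * koethe_seminorm a m (\<lambda>n. y n - x n)"
      using bound[of k] x by blast
    have "f y \<in> U" if y: "y \<in> koethe_ball a m x (\<epsilon> / C)" for y
    proof -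
      have "C * koethe_seminorm a m (\<lambda>n. y n - x n) < \<epsilon>"
        using y \<open>C > 0\<close> by (simp add: pos_less_divide_eq mult.commute)
      then show ?thesis
        using C[of y] f[of y] y sub by auto
    qed
    then show "\<exists>m. \<exists>\<delta>>0. koethe_ball a m x \<delta> \<subseteq> {x \<in> topspace (koethe_topology a). f x \<in> U}"
      using \<open>C > 0\<close> \<open>\<epsilon> > 0\<close> by (intro exI[of _ m] exI[of _ "\<epsilon> / C"]) auto
  qed auto
qed

section \<open>The Toeplitz operator as a convolution\<close>

definition toeplitz_image :: "(nat \<Rightarrow> 'a::real_normed_field) \<Rightarrow> (nat \<Rightarrow> 'a) \<Rightarrow> nat \<Rightarrow> 'a" where
  "toeplitz_image \<theta> x j = (\<Sum>n\<le>j. x n * toeplitz_column \<theta> n j)"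

lemma toeplitz_image_diff:
  "toeplitz_image \<theta> x j - toeplitz_image \<theta> y j = toeplitz_image \<theta> (\<lambda>n. x n - y n) j"
  by (simp add: toeplitz_image_def sum_subtractf left_diff_distrib)

lemma toeplitz_partial_sum:
  "(\<Sum>n<N. x n * toeplitz_column \<theta> n j) = toeplitz_image \<theta> (\<lambda>n. if n < N then x n else 0) j"
proof -
  have "(\<Sum>n<N. x n * toeplitz_column \<theta> n j)
      = (\<Sum>n\<in>{..<N} \<inter> {..j}. x n * toeplitz_column \<theta> n j)"
    by (rule sum.mono_neutral_right) (auto simp: toeplitz_column_def)
  also have "\<dots> = (\<Sum>n\<le>j. (if n < N then x n else 0) * toeplitz_column \<theta> n j)"
    by (rule sum.mono_neutral_cong_left) auto
  finally show ?thesis by (simp add: toeplitz_image_def)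
qed

text \<open>
  The partial sums of the series of columns are eventually constant in each coordinate, so the
  convolution is the only possible limit.
\<close>

lemma toeplitz_sums_to_unique:
  assumes b: "koethe_matrix b" and y: "toeplitz_sums_to b \<theta> x y"
  shows "y = toeplitz_image \<theta> x"
proof
  fix j
  have "(\<lambda>N. \<Sum>n<N. x n * toeplitz_column \<theta> n j) \<longlonglongrightarrow> y j"
    using limitin_koethe_coordinate[OF b y[unfolded toeplitz_sums_to_def]] .
  moreover have "(\<lambda>N. \<Sum>n<N. x n * toeplitz_column \<theta> n j) \<longlonglongrightarrow> toeplitz_image \<theta> x j"
  proof (rule tendsto_eventually, rule eventually_sequentiallyI[of "Suc j"])
    fix N assume "Suc j \<le> N"
    then show "(\<Sum>n<N. x n * toeplitz_column \<theta> n j) = toeplitz_image \<theta> x j"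
      unfolding toeplitz_partial_sum toeplitz_image_def by (intro sum.cong) auto
  qed
  ultimately show "y j = toeplitz_image \<theta> x j"
    using LIMSEQ_unique by blast
qed

lemma toeplitz_operator_eq:
  assumes "koethe_matrix b" and "toeplitz_sums_to b \<theta> x y"
  shows "toeplitz_operator b \<theta> x = toeplitz_image \<theta> x"
  unfolding toeplitz_operator_def using assms toeplitz_sums_to_unique by (metis the_equality)

lemma toeplitz_image_unit:
  "toeplitz_image \<theta> (\<lambda>i. if i = n then c else 0) = (\<lambda>j. c * toeplitz_column \<theta> n j)"
proof
  fix j
  have "toeplitz_image \<theta> (\<lambda>i. if i = n then c else 0) j
      = (\<Sum>i\<le>j. if i = n then c * toeplitz_column \<theta> n j else 0)"
    unfolding toeplitz_image_def by (intro sum.cong) auto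
  then show "toeplitz_image \<theta> (\<lambda>i. if i = n then c else 0) j = c * toeplitz_column \<theta> n j"
    by (simp add: toeplitz_column_def)
qed

text \<open>
  By the triangle inequality and exchange of the order of summation, the seminorm of the image is at
  most the sum of \<open>norm (x n)\<close> times the seminorm of the \<open>n\<close>-th column. The exchange
  is done on the finite square \<open>{..<J} \<times> {..<J}\<close>, which contains all nonzero terms of the first \<open>J\<close>
  coordinates of the image since the matrix is lower triangular.
\<close>

lemma toeplitz_image_bound:
  fixes \<theta> x :: "nat \<Rightarrow> 'a::real_normed_field"
  assumes b: "koethe_matrix b" and a: "koethe_matrix a"
    and column: "\<And>n. summable (\<lambda>j. norm (toeplitz_column \<theta> n j) * b j k)"
    and bound: "\<And>n. koethe_seminorm b k (toeplitz_column \<theta> n) \<le> C * a n m"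
    and x: "summable (\<lambda>n. norm (x n) * a n m)" and C: "0 \<le> C"
  shows "summable (\<lambda>j. norm (toeplitz_image \<theta> x j) * b j k)"
    and "koethe_seminorm b k (toeplitz_image \<theta> x) \<le> C * koethe_seminorm a m x"
proof -
  let ?c = "\<lambda>n j. norm (toeplitz_column \<theta> n j) * b j k"
  have c: "0 \<le> ?c n j" for n j
    by (simp add: koethe_matrix_nonneg[OF b])
  have partial: "(\<Sum>j<J. norm (toeplitz_image \<theta> x j) * b j k) \<le> C * koethe_seminorm a m x" for J
  proof -
    have "norm (toeplitz_image \<theta> x j) * b j k \<le> (\<Sum>n<J. norm (x n) * ?c n j)" if "j < J" for j
    proof -
      have "norm (toeplitz_image \<theta> x j) \<le> (\<Sum>n\<le>j. norm (x n) * norm (toeplitz_column \<theta> n j))"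
        unfolding toeplitz_image_def by (rule order_trans[OF norm_sum]) (simp add: norm_mult)
      then have "norm (toeplitz_image \<theta> x j) * b j k
          \<le> (\<Sum>n\<le>j. norm (x n) * norm (toeplitz_column \<theta> n j)) * b j k"
        by (intro mult_right_mono koethe_matrix_nonneg[OF b])
      also have "\<dots> = (\<Sum>n\<le>j. norm (x n) * ?c n j)"
        by (simp add: sum_distrib_right mult.assoc)
      also have "\<dots> \<le> (\<Sum>n<J. norm (x n) * ?c n j)"
        by (intro sum_mono2) (use that c in auto)
      finally show ?thesis .
    qed
    then have "(\<Sum>j<J. norm (toeplitz_image \<theta> x j) * b j k)
        \<le> (\<Sum>j<J. \<Sum>n<J. norm (x n) * ?c n j)"
      by (intro sum_mono) auto
    also have "\<dots> = (\<Sum>n<J. norm (x n) * (\<Sum>j<J. ?c n j))"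
      by (subst sum.swap) (simp add: sum_distrib_left)
    also have "\<dots> \<le> (\<Sum>n<J. norm (x n) * (C * a n m))"
    proof (intro sum_mono mult_left_mono)
      fix n
      have "(\<Sum>j<J. ?c n j) \<le> koethe_seminorm b k (toeplitz_column \<theta> n)"
        unfolding koethe_seminorm_def by (intro sum_le_suminf column) (auto intro: c)
      then show "(\<Sum>j<J. ?c n j) \<le> C * a n m"
        using bound order_trans by blast
    qed auto
    also have "\<dots> = C * (\<Sum>n<J. norm (x n) * a n m)"
      by (simp add: sum_distrib_left algebra_simps)
    also have "\<dots> \<le> C * koethe_seminorm a m x"
      unfolding koethe_seminorm_def
      by (intro mult_left_mono sum_le_suminf x C) (auto simp: koethe_matrix_nonneg[OF a])
    finally show ?thesis .
  qed
  show s: "summable (\<lambda>j. norm (toeplitz_image \<theta> x j) * b j k)"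
    by (rule summableI_nonneg_bounded[OF _ partial]) (simp add: koethe_matrix_nonneg[OF b])
  show "koethe_seminorm b k (toeplitz_image \<theta> x) \<le> C * koethe_seminorm a m x"
    unfolding koethe_seminorm_def[of b] by (rule suminf_le_const[OF s partial])
qed

lemma koethe_seminorm_tail_tendsto_0:
  assumes "x \<in> koethe_space a"
  shows "(\<lambda>N. koethe_seminorm a m (\<lambda>n. (if n < N then x n else 0) - x n)) \<longlonglongrightarrow> 0"
proof -
  let ?f = "\<lambda>n. norm (x n) * a n m"
  have s: "summable ?f"
    using assms by (simp add: koethe_space_def)
  have "koethe_seminorm a m (\<lambda>n. (if n < N then x n else 0) - x n) = (\<Sum>n. ?f n) - (\<Sum>n<N. ?f n)"
    for N
  proof -
    have "(\<lambda>n. ?f n - (if n \<in> {..<N} then ?f n else 0)) sums ((\<Sum>n. ?f n) - (\<Sum>n<N. ?f n))"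
      by (intro sums_diff summable_sums s sums_If_finite_set) auto
    moreover have "(\<lambda>n. ?f n - (if n \<in> {..<N} then ?f n else 0))
        = (\<lambda>n. norm ((if n < N then x n else 0) - x n) * a n m)"
      by auto
    ultimately show ?thesis
      unfolding koethe_seminorm_def by (simp add: sums_iff)
  qed
  then show ?thesis
    using tendsto_diff[OF tendsto_const[of "\<Sum>n. ?f n"] summable_LIMSEQ[OF s]] by simp
qed

text \<open>
  The error of the \<open>N\<close>-th partial sum of the series of columns and the difference of two images are
  both images of a difference, so the one estimate for images gives convergence and continuity.
\<close>

lemma toeplitz_well_defined_continuous:
  fixes \<theta> :: "nat \<Rightarrow> 'a::real_normed_field"
  assumes a: "koethe_matrix a" and b: "koethe_matrix b"
    and column: "\<And>n. toeplitz_column \<theta> n \<in> koethe_space b"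
    and bound: "\<And>k. \<exists>m. \<exists>C>0. \<forall>n. koethe_seminorm b k (toeplitz_column \<theta> n) \<le> C * a n m"
  shows "toeplitz_well_defined a b \<theta>"
    and "continuous_map (koethe_topology a) (koethe_topology b) (toeplitz_operator b \<theta>)"
proof -
  have summable_column: "summable (\<lambda>j. norm (toeplitz_column \<theta> n j) * b j k)" for n k
    using column by (simp add: koethe_space_def)
  have image: "toeplitz_image \<theta> x \<in> koethe_space b" if x: "x \<in> koethe_space a" for x
  proof -
    have "summable (\<lambda>j. norm (toeplitz_image \<theta> x j) * b j k)" for k
    proof -
      obtain m C where C: "C > 0" "\<And>n. koethe_seminorm b k (toeplitz_column \<theta> n) \<le> C * a n m"
        using bound by blast
      show ?thesis
        using x C(1) by (intro toeplitz_image_bound(1)[OF b a summable_column C(2)])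
          (auto simp: koethe_space_def)
    qed
    then show ?thesis by (simp add: koethe_space_def)
  qed
  have le: "\<exists>m. \<exists>C>0. \<forall>x\<in>koethe_space a.
      koethe_seminorm b k (toeplitz_image \<theta> x) \<le> C * koethe_seminorm a m x" for k
  proof -
    obtain m C where C: "C > 0" "\<And>n. koethe_seminorm b k (toeplitz_column \<theta> n) \<le> C * a n m"
      using bound by blast
    have "koethe_seminorm b k (toeplitz_image \<theta> x) \<le> C * koethe_seminorm a m x"
      if "x \<in> koethe_space a" for x
      using that C(1) by (intro toeplitz_image_bound(2)[OF b a summable_column C(2)])
        (auto simp: koethe_space_def)
    then show ?thesis
      using C(1) by blast
  qed
  have sums: "toeplitz_sums_to b \<theta> x (toeplitz_image \<theta> x)" if x: "x \<in> koethe_space a" for x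
    unfolding toeplitz_sums_to_def toeplitz_partial_sum
  proof (rule limitin_koetheI[OF b])
    have x': "(\<lambda>n. if n < N then x n else 0) \<in> koethe_space a" for N
    proof -
      have "(\<lambda>n. norm (if n < N then x n else 0) * a n k)
          = (\<lambda>n. if n \<in> {..<N} then norm (x n) * a n k else 0)" for k
        by auto
      then show ?thesis
        unfolding koethe_space_def using summable_If_finite_set[of "{..<N}"] by auto
    qed
    show "toeplitz_image \<theta> x \<in> koethe_space b"
      "toeplitz_image \<theta> (\<lambda>n. if n < N then x n else 0) \<in> koethe_space b" for N
      using image x x' by auto
    fix k
    obtain m C where C: "\<And>z. z \<in> koethe_space a \<Longrightarrow>
        koethe_seminorm b k (toeplitz_image \<theta> z) \<le> C * koethe_seminorm a m z"
      using le by blast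
    have "(\<lambda>N. C * koethe_seminorm a m (\<lambda>n. (if n < N then x n else 0) - x n)) \<longlonglongrightarrow> 0"
      using tendsto_mult_right_zero[OF koethe_seminorm_tail_tendsto_0[OF x]] .
    then show "(\<lambda>N. koethe_seminorm b k
        (\<lambda>j. toeplitz_image \<theta> (\<lambda>n. if n < N then x n else 0) j - toeplitz_image \<theta> x j)) \<longlonglongrightarrow> 0"
    proof (rule tendsto_sandwich[OF _ _ tendsto_const, rotated 2])
      show "\<forall>\<^sub>F N in sequentially. 0 \<le> koethe_seminorm b k
          (\<lambda>j. toeplitz_image \<theta> (\<lambda>n. if n < N then x n else 0) j - toeplitz_image \<theta> x j)"
        unfolding koethe_seminorm_def
        using koethe_space_diff[OF b image[OF x'] image[OF x]] koethe_matrix_nonneg[OF b]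
        by (intro always_eventually allI suminf_nonneg) (auto simp: koethe_space_def)
      show "\<forall>\<^sub>F N in sequentially. koethe_seminorm b k
          (\<lambda>j. toeplitz_image \<theta> (\<lambda>n. if n < N then x n else 0) j - toeplitz_image \<theta> x j)
        \<le> C * koethe_seminorm a m (\<lambda>n. (if n < N then x n else 0) - x n)"
        unfolding toeplitz_image_diff
        by (intro always_eventually allI C koethe_space_diff[OF a x' x])
    qed
  qed
  then show "toeplitz_well_defined a b \<theta>"
    unfolding toeplitz_well_defined_def using column by blast
  have operator: "toeplitz_operator b \<theta> x = toeplitz_image \<theta> x" if "x \<in> koethe_space a" for x
    using toeplitz_operator_eq[OF b sums[OF that]] .
  show "continuous_map (koethe_topology a) (koethe_topology b) (toeplitz_operator b \<theta>)"
  proof (rule continuous_map_koetheI[OF a b])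
    show "toeplitz_operator b \<theta> x \<in> koethe_space b" if "x \<in> koethe_space a" for x
      using that image operator by simp
    fix k
    obtain m C where "C > 0" and C: "\<And>z. z \<in> koethe_space a \<Longrightarrow>
        koethe_seminorm b k (toeplitz_image \<theta> z) \<le> C * koethe_seminorm a m z"
      using le by blast
    then show "\<exists>m. \<exists>C>0. \<forall>x\<in>koethe_space a. \<forall>y\<in>koethe_space a.
        koethe_seminorm b k (\<lambda>j. toeplitz_operator b \<theta> y j - toeplitz_operator b \<theta> x j)
          \<le> C * koethe_seminorm a m (\<lambda>n. y n - x n)"
      by (intro exI[of _ m] exI[of _ C])
        (simp add: operator toeplitz_image_diff koethe_space_diff[OF a])
  qed
qed

text \<open>
  Conversely, continuity at 0 gives \<open>m\<close> and \<open>\<delta>\<close> such that the \<open>m\<close>-th ball of radius \<open>\<delta>\<close>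
  is mapped into the \<open>k\<close>-th unit ball. Scalar multiples of the unit sequences in that ball yield
  a bound for each weighted entry of the matrix. If \<open>a n m = 0\<close>, all multiples are admissible, so
  that the weighted entry must vanish.
\<close>

lemma toeplitz_column_entry_bound:
  fixes \<theta> :: "nat \<Rightarrow> 'a::real_normed_field"
  assumes a: "koethe_matrix a" and b: "koethe_matrix b"
    and wd: "toeplitz_well_defined a b \<theta>"
    and cont: "continuous_map (koethe_topology a) (koethe_topology b) (toeplitz_operator b \<theta>)"
  shows "\<exists>m. \<exists>C>0. \<forall>n j. norm (toeplitz_column \<theta> n j) * b j k \<le> C * a n m"
proof -
  let ?T = "toeplitz_operator b \<theta>"
  have operator: "?T x = toeplitz_image \<theta> x" if "x \<in> koethe_space a" for x
    using wd that toeplitz_operator_eq[OF b] unfolding toeplitz_well_defined_def by metis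
  have zero: "(\<lambda>n. 0::'a) \<in> koethe_space a" "(\<lambda>n. 0::'a) \<in> koethe_space b"
    by (auto simp: koethe_space_def)
  let ?V = "{x \<in> topspace (koethe_topology a). ?T x \<in> koethe_ball b k (\<lambda>n. 0) 1}"
  have "openin (koethe_topology a) ?V"
    using openin_continuous_map_preimage[OF cont openin_koethe_ball[OF zero(2)]] by simp
  moreover have "(\<lambda>n. 0) \<in> ?V"
    using zero operator[OF zero(1)]
    by (simp add: toeplitz_image_def koethe_seminorm_def koethe_space_def)
  ultimately have "\<exists>m. \<exists>\<delta>>0. koethe_ball a m (\<lambda>n. 0) \<delta> \<subseteq> ?V"
    unfolding openin_koethe_topology_iff[OF a] by (elim conjE bspec)
  then obtain m \<delta> where "\<delta> > 0" and sub: "koethe_ball a m (\<lambda>n. 0) \<delta> \<subseteq> ?V"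
    by (elim exE conjE)
  have test: "\<bar>c\<bar> * (norm (toeplitz_column \<theta> n j) * b j k) < 1" if c: "\<bar>c\<bar> * a n m < \<delta>" for c n j
  proof -
    let ?e = "\<lambda>i. if i = n then of_real c else 0 :: 'a"
    have e_eq: "(\<lambda>i. norm (?e i) * a i l) = (\<lambda>i. if i = n then \<bar>c\<bar> * a i l else 0)" for l
      by auto
    have weights: "(\<lambda>i. norm (?e i) * a i l) sums (\<bar>c\<bar> * a n l)" for l
      unfolding e_eq by (rule sums_single)
    have e: "?e \<in> koethe_space a"
      unfolding koethe_space_def using weights sums_summable by blast
    have "?e \<in> koethe_ball a m (\<lambda>n. 0) \<delta>"
      using e c sums_unique[OF weights[of m]] by (simp add: koethe_seminorm_def)
    then have "?T ?e \<in> koethe_ball b k (\<lambda>n. 0) 1"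
      using sub by blast
    then have *: "(\<lambda>j. of_real c * toeplitz_column \<theta> n j) \<in> koethe_space b"
        "koethe_seminorm b k (\<lambda>j. of_real c * toeplitz_column \<theta> n j) < 1"
      unfolding operator[OF e] toeplitz_image_unit by auto
    show ?thesis
      using coordinate_le_koethe_seminorm[OF b *(1), of j k] *(2) by (simp add: norm_mult mult.assoc)
  qed
  have "norm (toeplitz_column \<theta> n j) * b j k \<le> 2 / \<delta> * a n m" for n j
  proof (cases "a n m = 0")
    case True
    let ?r = "norm (toeplitz_column \<theta> n j) * b j k"
    \<comment> \<open>Otherwise the multiple \<open>1 / ?r\<close> of the unit sequence would reach the excluded value 1.\<close>
    have "?r = 0"
      using test[of "1 / ?r" n j] True \<open>\<delta> > 0\<close> koethe_matrix_nonneg[OF b, of j k]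
      by (auto split: if_splits)
    then show ?thesis
      using True by auto
  next
    case False
    then have pos: "a n m > 0"
      using koethe_matrix_nonneg[OF a, of n m] by simp
    then have "\<bar>\<delta> / (2 * a n m)\<bar> * (norm (toeplitz_column \<theta> n j) * b j k) < 1"
      using \<open>\<delta> > 0\<close> by (intro test) simp
    then show ?thesis
      using pos \<open>\<delta> > 0\<close> by (simp add: field_simps)
  qed
  then show ?thesis
    using \<open>\<delta> > 0\<close> by (intro exI[of _ m] exI[of _ "2 / \<delta>"]) auto
qed

section \<open>Columns in power series spaces of finite type\<close>

text \<open>
  As \<open>\<beta>\<close> increases, \<open>\<beta> (n + s)\<close> and \<open>\<beta> t\<close> are at most \<open>\<beta> (n + t)\<close>, hence so is their mean. Halving doubles the
  denominator \<open>Suc k\<close> of the exponent, and \<open>2 * Suc k = Suc (Suc (2 * k))\<close> belongs to the index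
  \<open>Suc (2 * k)\<close>.
\<close>

lemma finite_type_weight_le:
  assumes "incseq \<beta>" and "s \<le> t"
  shows "finite_type_matrix \<beta> (n + t) k
    \<le> finite_type_matrix \<beta> (n + s) (Suc (2 * k)) * finite_type_matrix \<beta> t (Suc (2 * k))"
proof -
  have "\<beta> (n + s) \<le> \<beta> (n + t)" "\<beta> t \<le> \<beta> (n + t)"
    using assms by (auto intro: incseqD)
  then have "(\<beta> (n + s) + \<beta> t) / (2 * real (Suc k)) \<le> 2 * \<beta> (n + t) / (2 * real (Suc k))"
    by (intro divide_right_mono) auto
  moreover have "real (Suc (Suc (2 * k))) = 2 * real (Suc k)"
    by simp
  ultimately show ?thesis
    unfolding finite_type_matrix_def mult_exp_exp
    by (simp add: add_divide_distrib del: of_nat_Suc)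
qed

text \<open>
  Passing to the larger index \<open>Suc (2 * k)\<close> splits off the weight of the leading entry: what remains
  of the sum no longer depends on \<open>n\<close>. The entries of \<open>\<theta>\<close> before \<open>s\<close>, for which the weight estimate may
  fail, are zero.
\<close>

lemma toeplitz_column_seminorm_le:
  fixes \<theta> :: "nat \<Rightarrow> 'a::real_normed_field"
  assumes \<beta>: "exponent_sequence \<beta>" and \<theta>: "\<theta> \<in> power_series_space_finite_type \<beta>"
    and s: "\<And>t. t < s \<Longrightarrow> \<theta> t = 0"
  shows "toeplitz_column \<theta> n \<in> power_series_space_finite_type \<beta>"
    and "koethe_seminorm (finite_type_matrix \<beta>) k (toeplitz_column \<theta> n)
      \<le> koethe_seminorm (finite_type_matrix \<beta>) (Suc (2 * k)) \<theta>
        * finite_type_matrix \<beta> (n + s) (Suc (2 * k))"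
proof -
  let ?b = "finite_type_matrix \<beta>"
  have inc: "incseq \<beta>"
    using \<beta> by (simp add: exponent_sequence_def)
  have s\<theta>: "summable (\<lambda>t. norm (\<theta> t) * ?b t l)" for l
    using \<theta> by (simp add: koethe_space_def)
  have le: "norm (\<theta> t) * ?b (t + n) l
      \<le> norm (\<theta> t) * ?b t (Suc (2 * l)) * ?b (n + s) (Suc (2 * l))" for t l
  proof (cases "t < s")
    case False
    then show ?thesis
      using mult_left_mono[OF finite_type_weight_le[OF inc, of s t n l], of "norm (\<theta> t)"]
      by (simp add: mult_ac add.commute)
  qed (simp add: s)
  have shifted: "summable (\<lambda>t. norm (\<theta> t) * ?b (t + n) l)" for l
    by (rule summable_comparison_test'[OF summable_mult2[OF s\<theta>[of "Suc (2 * l)"]]])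
      (use le in \<open>auto simp: finite_type_matrix_def\<close>)
  have column: "(\<lambda>t. norm (toeplitz_column \<theta> n (t + n)) * ?b (t + n) l)
      = (\<lambda>t. norm (\<theta> t) * ?b (t + n) l)" for l
    by (simp add: toeplitz_column_def)
  have sc: "summable (\<lambda>j. norm (toeplitz_column \<theta> n j) * ?b j l)" for l
    using shifted[of l] unfolding column[symmetric]
    by (rule summable_iff_shift[of "\<lambda>j. norm (toeplitz_column \<theta> n j) * ?b j l" n, THEN iffD1])
  then show "toeplitz_column \<theta> n \<in> power_series_space_finite_type \<beta>"
    by (simp add: koethe_space_def)
  have "koethe_seminorm ?b k (toeplitz_column \<theta> n) = (\<Sum>t. norm (\<theta> t) * ?b (t + n) k)"
    unfolding koethe_seminorm_def suminf_split_initial_segment[OF sc, of _ n] column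
    by (simp add: toeplitz_column_def)
  also have "\<dots> \<le> (\<Sum>t. norm (\<theta> t) * ?b t (Suc (2 * k)) * ?b (n + s) (Suc (2 * k)))"
    by (intro suminf_le le shifted summable_mult2 s\<theta>)
  also have "\<dots> = koethe_seminorm ?b (Suc (2 * k)) \<theta> * ?b (n + s) (Suc (2 * k))"
    unfolding koethe_seminorm_def by (rule suminf_mult2[OF s\<theta>, symmetric])
  finally show "koethe_seminorm ?b k (toeplitz_column \<theta> n)
      \<le> koethe_seminorm ?b (Suc (2 * k)) \<theta> * ?b (n + s) (Suc (2 * k))" .
qed

theorem theorem3p3:
  fixes a :: "nat \<Rightarrow> nat \<Rightarrow> real" and \<beta> :: "nat \<Rightarrow> real"
    and \<theta> :: "nat \<Rightarrow> 'a::real_normed_field" and s0 :: nat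
  assumes "koethe_matrix a"
    and "exponent_sequence \<beta>"
    and "infinite {t. \<theta> t \<noteq> 0}"
    and "s0 = (LEAST t. \<theta> t \<noteq> 0)"
  shows "toeplitz_well_defined a (finite_type_matrix \<beta>) \<theta> \<and>
      continuous_map (koethe_topology a) (koethe_topology (finite_type_matrix \<beta>))
        (toeplitz_operator (finite_type_matrix \<beta>) \<theta>) \<longleftrightarrow>
    \<theta> \<in> power_series_space_finite_type \<beta> \<and>
    (\<forall>k. \<exists>m. \<exists>C>0. \<forall>n. exp (- (1 / real (Suc k)) * \<beta> (n + s0)) \<le> C * a n m)"
proof
  let ?b = "finite_type_matrix \<beta>"
  note b = koethe_matrix_finite_type[OF assms(2)]
  have "\<exists>t. \<theta> t \<noteq> 0"
    using assms(3) not_finite_existsD by auto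
  then have s0: "\<theta> s0 \<noteq> 0"
    unfolding assms(4) by (rule LeastI_ex)
  have below: "\<theta> t = 0" if "t < s0" for t
    using that not_less_Least unfolding assms(4) by blast
  {
    assume *: "toeplitz_well_defined a ?b \<theta> \<and>
      continuous_map (koethe_topology a) (koethe_topology ?b) (toeplitz_operator ?b \<theta>)"
    have "toeplitz_column \<theta> 0 \<in> power_series_space_finite_type \<beta>"
      using * by (simp add: toeplitz_well_defined_def)
    moreover have "toeplitz_column \<theta> 0 = \<theta>"
      by (simp add: toeplitz_column_def fun_eq_iff)
    moreover have "\<exists>m. \<exists>C>0. \<forall>n. exp (- (1 / real (Suc k)) * \<beta> (n + s0)) \<le> C * a n m" for k
    proof -
      obtain m C where "C > 0"
        and C: "\<And>n j. norm (toeplitz_column \<theta> n j) * ?b j k \<le> C * a n m"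
        using toeplitz_column_entry_bound[OF assms(1) b] * by blast
      have "exp (- (1 / real (Suc k)) * \<beta> (n + s0)) \<le> C / norm (\<theta> s0) * a n m" for n
        using C[of n "n + s0"] s0
        by (simp add: toeplitz_column_def finite_type_matrix_def pos_le_divide_eq mult.commute
            del: of_nat_Suc)
      then show ?thesis
        using \<open>C > 0\<close> s0 by (intro exI[of _ m] exI[of _ "C / norm (\<theta> s0)"]) auto
    qed
    ultimately show "\<theta> \<in> power_series_space_finite_type \<beta> \<and>
        (\<forall>k. \<exists>m. \<exists>C>0. \<forall>n. exp (- (1 / real (Suc k)) * \<beta> (n + s0)) \<le> C * a n m)"
      by simp
  next
    assume *: "\<theta> \<in> power_series_space_finite_type \<beta> \<and>
      (\<forall>k. \<exists>m. \<exists>C>0. \<forall>n. exp (- (1 / real (Suc k)) * \<beta> (n + s0)) \<le> C * a n m)"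
    note column = toeplitz_column_seminorm_le[OF assms(2) conjunct1[OF *] below]
    have bound: "\<exists>m. \<exists>C>0. \<forall>n. koethe_seminorm ?b k (toeplitz_column \<theta> n) \<le> C * a n m" for k
    proof -
      obtain m C where "C > 0" and C: "\<And>n. ?b (n + s0) (Suc (2 * k)) \<le> C * a n m"
        using * unfolding finite_type_matrix_def by blast
      let ?S = "koethe_seminorm ?b (Suc (2 * k)) \<theta>"
      have "0 < norm (\<theta> s0) * ?b s0 (Suc (2 * k))"
        using s0 by (simp add: finite_type_matrix_def)
      also have "\<dots> \<le> ?S"
        using coordinate_le_koethe_seminorm[OF b conjunct1[OF *]] .
      finally have "?S > 0" .
      have "koethe_seminorm ?b k (toeplitz_column \<theta> n) \<le> ?S * C * a n m" for n
        using order_trans[OF column(2) mult_left_mono[OF C[of n]]] \<open>?S > 0\<close> by (simp add: mult.assoc)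
      then show ?thesis
        using \<open>?S > 0\<close> \<open>C > 0\<close> by (intro exI[of _ m] exI[of _ "?S * C"]) auto
    qed
    show "toeplitz_well_defined a ?b \<theta> \<and>
        continuous_map (koethe_topology a) (koethe_topology ?b) (toeplitz_operator ?b \<theta>)"
      by (intro conjI toeplitz_well_defined_continuous[OF assms(1) b column(1) bound])
  }
qed

end
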